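(* Let $n\ge 2$ be an integer and let $d=2$. Then the dual of the $(n,d)$ Delsarte linear program has a unique optimum if and only if $n=2$.
   Context: $[a,b]=\{x\in\mathbb{Z}: a\le x\le b\}$ and $[a]=\{1,\dots,a\}$. $\binom{a}{b}=0$ unless $0\le b\le a$. For $0\le i,j\le n$, the Krawtchouk polynomial is $K_j(i)=K_j(i;n)=\sum_{k=0}^j(-1)^k\binom{i}{k}\binom{n-i}{j-k}$. For integers $1\le d\le n$, the dual of the $(n,d)$ Delsarte linear program is the following linear program in real variables $c=(c_0,\dots,c_n)$: minimize $\sum_{j=0}^n c_j\binom{n}{j}$ subject to $\sum_{j=0}^n c_jK_j(i)\le 0$ for all $i\in[d,n]$; $c_j\ge 0$ for all $j\in[n]$; $c_0=1$. An optimum is a feasible point achieving the optimal objective value. *)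

theory Defs
  imports Complex_Main "HOL-Library.FuncSet"
begin

text \<open>The value \<open>K\<^sub>j(i; n)\<close>, for \<open>i, j \<le> n\<close>. In this range the truncated subtractions
  \<open>n - i\<close> and \<open>j - k\<close> are genuine ones.\<close>

definition krawtchouk :: "nat \<Rightarrow> nat \<Rightarrow> nat \<Rightarrow> real" where
  "krawtchouk n j i = (\<Sum>k=0..j. (- 1) ^ k * real (i choose k) * real ((n - i) choose (j - k)))"

definition delsarte_dual_objective :: "nat \<Rightarrow> (nat \<Rightarrow> real) \<Rightarrow> real" where
  "delsarte_dual_objective n c = (\<Sum>j=0..n. c j * real (n choose j))"

text \<open>A vector \<open>(c\<^sub>0, \<dots>, c\<^sub>n)\<close> is a function that is \<^const>\<open>extensional\<close> on \<open>{0..n}\<close>, so that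
  distinct functions represent distinct vectors and uniqueness statements have their usual meaning.\<close>

definition delsarte_dual_feasible :: "nat \<Rightarrow> nat \<Rightarrow> (nat \<Rightarrow> real) \<Rightarrow> bool" where
  "delsarte_dual_feasible n d c \<longleftrightarrow>
     c \<in> extensional {0..n} \<and>
     (\<forall>i\<in>{d..n}. (\<Sum>j=0..n. c j * krawtchouk n j i) \<le> 0) \<and>
     (\<forall>j\<in>{1..n}. c j \<ge> 0) \<and>
     c 0 = 1"

definition delsarte_dual_optimum :: "nat \<Rightarrow> nat \<Rightarrow> (nat \<Rightarrow> real) \<Rightarrow> bool" where
  "delsarte_dual_optimum n d c \<longleftrightarrow>
     is_arg_min (delsarte_dual_objective n) (delsarte_dual_feasible n d) c"

end

theory Submission
  imports Defs "HOL-Computational_Algebra.Polynomial"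
begin

text \<open>
  Write \<open>f i = (\<Sum>j\<le>n. c j * K\<^sub>j(i))\<close> for the transform of a vector \<open>c\<close>. The objective is \<open>f 0\<close>, and the
  constraints for \<open>d = 2\<close> say that \<open>f i \<le> 0\<close> for every \<open>i \<ge> 2\<close>.

  Lower bound. The code of even-weight words has size \<open>2 ^ (n - 1)\<close> and minimum distance 2, and its
  weight distribution certifies a bound on the dual: summing \<open>f i\<close> with weight \<open>n choose i\<close> over even
  \<open>i\<close> gives exactly \<open>2 ^ (n - 1) * (c 0 + c n)\<close>, while all terms except \<open>f 0\<close> are nonpositive
  (the free index \<open>i = 1\<close> is odd). Hence \<open>f 0 \<ge> 2 ^ (n - 1) * (1 + c n)\<close>
  (lemma \<open>delsarte_dual_objective_ge\<close>).

  Attainment. The vector \<open>c j = 1 - j / n\<close> is feasible, its transform vanishes at every \<open>i \<ge> 2\<close>, and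
  its objective is \<open>2 ^ (n - 1)\<close>.

  Uniqueness. All coordinates of this optimum other than the last are bounded away from 0, so one can
  move a little in any direction \<open>\<delta>\<close> with \<open>\<delta> 0 = \<delta> n = 0\<close> whose transform vanishes at 0 and is
  nonpositive at all \<open>i \<ge> 2\<close> (lemma \<open>perturbed_linear_optimum\<close>). Such a direction exists as soon as there
  is an odd index \<open>m\<close> with \<open>3 \<le> m \<le> n\<close>: it lowers \<open>f m\<close> below 0 and raises \<open>f 1\<close> to compensate, leaving
  all other values alone. For the largest such \<open>m\<close> the direction has a closed form
  (lemma \<open>perturbation_exists\<close>). For \<open>n = 2\<close> there is no such \<open>m\<close>, and the constraint at
  \<open>i = 2\<close> together with \<open>c 2 \<ge> 0\<close> leaves only one vector of value 2.
\<close>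

section \<open>The generating polynomial of the Krawtchouk values\<close>

text \<open>This is \<open>(1 - z) ^ i * (1 + z) ^ (n - i)\<close> as a polynomial in \<open>z\<close>; its coefficients are the
  values \<open>K\<^sub>j(i; n)\<close>. Sums of \<open>K\<^sub>j(i)\<close> over \<open>j\<close> thereby become evaluations at 1 or -1 of this polynomial
  and of its derivative.\<close>

definition krawtchouk_gen :: "nat \<Rightarrow> nat \<Rightarrow> real poly" where
  "krawtchouk_gen n i = [:1, -1:] ^ i * [:1, 1:] ^ (n - i)"

lemma coeff_one_plus_power: "coeff ([:1, a:] ^ m) k = real (m choose k) * a ^ k"
proof (induction m arbitrary: k)
  case 0
  then show ?case by (cases k) auto
next
  case (Suc m)
  then show ?case by (cases k) (auto simp: algebra_simps)
qed

lemma coeff_krawtchouk_gen: "coeff (krawtchouk_gen n i) j = krawtchouk n j i"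
  unfolding krawtchouk_gen_def krawtchouk_def coeff_mult atLeast0AtMost
  by (simp add: coeff_one_plus_power mult_ac)

lemma degree_krawtchouk_gen:
  assumes "i \<le> n"
  shows "degree (krawtchouk_gen n i) \<le> n"
proof -
  have "degree (krawtchouk_gen n i) \<le> degree ([:1, -1:] ^ i :: real poly) + degree ([:1, 1:] ^ (n - i) :: real poly)"
    unfolding krawtchouk_gen_def by (rule degree_mult_le)
  also have "\<dots> \<le> n"
    using assms by (simp add: degree_power_eq)
  finally show ?thesis .
qed

lemma poly_eq_sum_upto:
  fixes p :: "real poly"
  assumes "degree p \<le> n"
  shows "poly p z = (\<Sum>j=0..n. coeff p j * z ^ j)"
  unfolding poly_altdef atLeast0AtMost
  by (rule sum.mono_neutral_left) (use assms in \<open>auto simp: coeff_eq_0\<close>)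

lemma sum_power_times_krawtchouk:
  assumes "i \<le> n"
  shows "(\<Sum>j=0..n. z ^ j * krawtchouk n j i) = (1 - z) ^ i * (1 + z) ^ (n - i)"
proof -
  have "(\<Sum>j=0..n. z ^ j * krawtchouk n j i) = poly (krawtchouk_gen n i) z"
    using poly_eq_sum_upto[OF degree_krawtchouk_gen[OF assms], of z]
    by (simp add: coeff_krawtchouk_gen mult.commute)
  then show ?thesis
    by (simp add: krawtchouk_gen_def poly_power algebra_simps)
qed

lemma sum_index_power_times_krawtchouk:
  assumes "i \<le> n"
  shows "(\<Sum>j=0..n. real j * z ^ j * krawtchouk n j i) =
    z * (real (n - i) * (1 - z) ^ i * (1 + z) ^ (n - i - 1) - real i * (1 - z) ^ (i - 1) * (1 + z) ^ (n - i))"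
proof -
  let ?p = "krawtchouk_gen n i"
  have "(\<Sum>j=0..n. real j * z ^ j * krawtchouk n j i) = z * poly (pderiv ?p) z"
  proof -
    have d: "degree (pCons 0 (pderiv ?p)) \<le> n"
      using degree_krawtchouk_gen[OF assms]
      by (intro degree_le allI impI) (auto simp: coeff_pCons coeff_pderiv coeff_eq_0 split: nat.splits)
    have "z * poly (pderiv ?p) z = (\<Sum>j=0..n. coeff (pCons 0 (pderiv ?p)) j * z ^ j)"
      using poly_eq_sum_upto[OF d, of z] by simp
    also have "\<dots> = (\<Sum>j=0..n. real j * z ^ j * krawtchouk n j i)"
      by (intro sum.cong refl)
         (auto simp: coeff_pCons coeff_pderiv coeff_krawtchouk_gen split: nat.splits)
    finally show ?thesis by simp
  qed
  then show ?thesis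
    by (simp add: krawtchouk_gen_def pderiv_mult pderiv_power poly_power pderiv_pCons algebra_simps)
qed

text \<open>The four families of coefficients from which all vectors below are built: the constant 1 is
  \<open>K\<^sub>0(j)\<close>, \<open>n - 2 * j\<close> is \<open>K\<^sub>1(j)\<close>, \<open>(-1) ^ j\<close> is \<open>K\<^sub>n(j)\<close>, and the product of the last two is
  \<open>K\<^bsub>n-1\<^esub>(j)\<close>. By orthogonality the transform of \<open>K\<^sub>m(j)\<close> is concentrated on the index \<open>m\<close>.\<close>

lemma sum_krawtchouk:
  assumes "i \<le> n"
  shows "(\<Sum>j=0..n. krawtchouk n j i) = (if i = 0 then 2 ^ n else 0)"
  using sum_power_times_krawtchouk[OF assms, of 1] by (simp add: power_0_left)

lemma sum_alternating_krawtchouk: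
  assumes "i \<le> n"
  shows "(\<Sum>j=0..n. (-1) ^ j * krawtchouk n j i) = (if i = n then 2 ^ n else 0)"
  using sum_power_times_krawtchouk[OF assms, of "-1"] assms by (auto simp: power_0_left)

lemma sum_linear_power_krawtchouk:
  "(\<Sum>j=0..n. (real n - 2 * real j) * z ^ j * krawtchouk n j i) =
    real n * (\<Sum>j=0..n. z ^ j * krawtchouk n j i) - 2 * (\<Sum>j=0..n. real j * z ^ j * krawtchouk n j i)"
  unfolding sum_distrib_left sum_subtractf[symmetric] by (intro sum.cong refl) (simp add: algebra_simps)

lemma sum_linear_krawtchouk:
  assumes "i \<le> n" "i \<noteq> 1"
  shows "(\<Sum>j=0..n. (real n - 2 * real j) * krawtchouk n j i) = 0"
proof -
  have "(\<Sum>j=0..n. (real n - 2 * real j) * krawtchouk n j i) =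
      real n * (0 ^ i * 2 ^ (n - i)) -
      2 * (real (n - i) * 0 ^ i * 2 ^ (n - i - 1) - real i * 0 ^ (i - 1) * 2 ^ (n - i))"
    using sum_linear_power_krawtchouk[of n 1 i] sum_power_times_krawtchouk[OF assms(1), of 1]
      sum_index_power_times_krawtchouk[OF assms(1), of 1] by simp
  also have "\<dots> = 0"
  proof (cases "i = 0")
    case True
    then show ?thesis by (cases n) auto
  next
    case False
    then have "i - 1 \<noteq> 0" using assms(2) by simp
    with False show ?thesis by (simp add: power_0_left)
  qed
  finally show ?thesis .
qed

lemma sum_alternating_linear_krawtchouk:
  assumes "i \<le> n" "n \<ge> 1"
  shows "(\<Sum>j=0..n. (real n - 2 * real j) * (-1) ^ j * krawtchouk n j i) =
    (if i = n - 1 then 2 ^ n else 0)"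
proof -
  have "(\<Sum>j=0..n. (real n - 2 * real j) * (-1) ^ j * krawtchouk n j i) =
      real n * (2 ^ i * 0 ^ (n - i)) +
      2 * (real (n - i) * 2 ^ i * 0 ^ (n - i - 1) - real i * 2 ^ (i - 1) * 0 ^ (n - i))"
    using sum_linear_power_krawtchouk[of n "-1" i] sum_power_times_krawtchouk[OF assms(1), of "-1"]
      sum_index_power_times_krawtchouk[OF assms(1), of "-1"] by simp
  also have "\<dots> = (if i = n - 1 then 2 ^ n else 0)"
  proof -
    consider "i = n" | "n = Suc i" | "n - i \<noteq> 0" "n - i - 1 \<noteq> 0" using assms by linarith
    then show ?thesis
    proof cases
      case 1
      then show ?thesis using assms by (cases n) auto
    next
      case 3
      then have "i \<noteq> n - 1" by linarith
      with 3 show ?thesis by (simp add: power_0_left)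
    qed simp
  qed
  finally show ?thesis .
qed

lemma krawtchouk_zero_right: "krawtchouk n j 0 = real (n choose j)"
  using coeff_krawtchouk_gen[of n 0 j] by (simp add: krawtchouk_gen_def coeff_one_plus_power)

lemma delsarte_dual_objective_eq:
  "delsarte_dual_objective n c = (\<Sum>j=0..n. c j * krawtchouk n j 0)"
  by (simp add: delsarte_dual_objective_def krawtchouk_zero_right)

section \<open>The lower bound\<close>

text \<open>This is the MacWilliams identity for the even-weight code: its weight distribution is transformed
  into that of the dual code, the repetition code, which has words of weight 0 and \<open>n\<close> only. By the binomial
  theorem, the generating polynomials with weights \<open>n choose i\<close> and \<open>(-1) ^ i * (n choose i)\<close> sum to
  \<open>((1 + z) + (1 - z)) ^ n\<close> and \<open>((1 + z) - (1 - z)) ^ n\<close>. The factor \<open>1 + (-1) ^ i\<close> counts each even \<open>i\<close>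
  twice.\<close>

lemma sum_binomial_even_krawtchouk:
  assumes "n \<ge> 1" "j \<le> n"
  shows "(\<Sum>i=0..n. (1 + (-1) ^ i) * real (n choose i) * krawtchouk n j i) =
    (if j = 0 \<or> j = n then 2 ^ n else 0)"
proof -
  let ?w = "\<lambda>a i. smult (a ^ i * real (n choose i)) (krawtchouk_gen n i)"
  have bin: "(\<Sum>i=0..n. ?w a i) = ([:a, -a:] + [:1, 1:]) ^ n" for a :: real
  proof -
    have "[:a, -a:] ^ i = smult (a ^ i) ([:1, -1:] ^ i)" for i
      using smult_power[of a "[:1, -1:]" i] by simp
    then show ?thesis
      unfolding binomial_ring atLeast0AtMost krawtchouk_gen_def
      by (intro sum.cong refl) (simp add: of_nat_poly mult_ac)
  qed
  have "(\<Sum>i=0..n. (1 + (-1) ^ i) * real (n choose i) * krawtchouk n j i) =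
      coeff ((\<Sum>i=0..n. ?w 1 i) + (\<Sum>i=0..n. ?w (-1) i)) j"
    by (simp add: coeff_sum coeff_krawtchouk_gen sum.distrib algebra_simps)
  also have "\<dots> = coeff ([:2:] ^ n + [:0, 2:] ^ n) j"
    unfolding bin by simp
  also have "[:2:] ^ n + [:0, 2:] ^ n = monom (2 ^ n :: real) 0 + monom (2 ^ n) n"
  proof -
    have "[:0, 2 :: real:] = monom 2 1" "[:2 :: real:] = monom 2 0"
      by (simp_all add: monom_altdef)
    then show ?thesis by (simp add: monom_power)
  qed
  finally show ?thesis using assms by auto
qed

lemma delsarte_dual_objective_ge:
  assumes "n \<ge> 1" "delsarte_dual_feasible n 2 c"
  shows "delsarte_dual_objective n c \<ge> 2 ^ (n - 1) * (1 + c n)"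
proof -
  define f where "f i = (\<Sum>j=0..n. c j * krawtchouk n j i)" for i
  let ?w = "\<lambda>i. (1 + (-1) ^ i) * real (n choose i)"
  have f0: "f 0 = delsarte_dual_objective n c"
    by (simp add: f_def delsarte_dual_objective_eq)
  \<comment> \<open>At \<open>i = 1\<close>, where \<open>f\<close> is unconstrained, the weight is 0.\<close>
  have neg: "?w i * f i \<le> 0" if "i \<in> {1..n}" for i
  proof (cases "i = 1")
    case False
    then have "f i \<le> 0"
      using that assms(2) by (auto simp: delsarte_dual_feasible_def f_def)
    then show ?thesis
      by (intro mult_nonneg_nonpos) (auto simp: minus_one_power_iff)
  qed auto
  have "2 ^ n * (1 + c n) = (\<Sum>j=0..n. c j * (if j = 0 \<or> j = n then 2 ^ n else 0))"
  proof -
    have "(\<Sum>j=0..n. c j * (if j = 0 \<or> j = n then 2 ^ n else 0)) = (\<Sum>j\<in>{0, n}. c j * 2 ^ n)"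
      by (rule sum.mono_neutral_cong_right) auto
    then show ?thesis
      using assms by (auto simp: delsarte_dual_feasible_def algebra_simps)
  qed
  also have "\<dots> = (\<Sum>j=0..n. c j * (\<Sum>i=0..n. ?w i * krawtchouk n j i))"
    by (intro sum.cong refl) (use sum_binomial_even_krawtchouk[OF assms(1)] in auto)
  also have "\<dots> = (\<Sum>i=0..n. ?w i * f i)"
    unfolding f_def sum_distrib_left by (subst sum.swap) (simp add: mult_ac)
  also have "\<dots> = 2 * f 0 + (\<Sum>i=1..n. ?w i * f i)"
    by (subst sum.atLeast_Suc_atMost) simp_all
  also have "\<dots> \<le> 2 * f 0"
    using sum_nonpos[of "{1..n}", OF neg] by simp
  finally show ?thesis
    using assms(1) f0 by (cases n) auto
qed

lemma delsarte_dual_objective_ge_half: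
  assumes "n \<ge> 1" "delsarte_dual_feasible n 2 c"
  shows "delsarte_dual_objective n c \<ge> 2 ^ (n - 1)"
proof -
  have "c n \<ge> 0" using assms by (auto simp: delsarte_dual_feasible_def)
  then have "2 ^ (n - 1) \<le> 2 ^ (n - 1) * (1 + c n)" by simp
  then show ?thesis using delsarte_dual_objective_ge[OF assms] by linarith
qed

section \<open>A linear optimum and its perturbations\<close>

text \<open>The hypotheses on \<open>\<delta>\<close> keep the objective and the sign constraints intact. Nonnegativity of the
  coordinates survives because \<open>1 - j / n \<ge> 1 / n\<close> for \<open>j < n\<close>, which is the size of the bound on \<open>t\<close> times that on
  \<open>\<delta>\<close>.\<close>

lemma perturbed_linear_optimum:
  fixes t :: real
  assumes n: "n \<ge> 1"
    and ends: "\<delta> 0 = 0" "\<delta> n = 0"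
    and bound: "\<And>j. j \<le> n \<Longrightarrow> \<bar>\<delta> j\<bar> \<le> 2 * real n"
    and obj: "(\<Sum>j=0..n. \<delta> j * krawtchouk n j 0) = 0"
    and constr: "\<And>i. 2 \<le> i \<Longrightarrow> i \<le> n \<Longrightarrow> (\<Sum>j=0..n. \<delta> j * krawtchouk n j i) \<le> 0"
    and t: "0 \<le> t" "t \<le> 1 / (2 * real n ^ 2)"
  defines "c \<equiv> restrict (\<lambda>j. 1 - real j / real n + t * \<delta> j) {0..n}"
  shows "delsarte_dual_objective n c = 2 ^ (n - 1)" "delsarte_dual_optimum n 2 c"
proof -
  \<comment> \<open>Use \<open>1 - j / n = 1 / 2 + (n - 2 * j) / (2 * n)\<close>, whose two parts have known transforms.\<close>
  have transform: "(\<Sum>j=0..n. c j * krawtchouk n j i) =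
      (if i = 0 then 2 ^ n / 2 else 0) + t * (\<Sum>j=0..n. \<delta> j * krawtchouk n j i)"
    if i: "i \<le> n" "i \<noteq> 1" for i
  proof -
    have "(\<Sum>j=0..n. c j * krawtchouk n j i) =
      (\<Sum>j=0..n. 1 / 2 * krawtchouk n j i
        + 1 / (2 * real n) * ((real n - 2 * real j) * krawtchouk n j i)
        + t * (\<delta> j * krawtchouk n j i))"
      using n by (intro sum.cong refl) (simp add: c_def field_simps)
    also have "\<dots> = 1 / 2 * (\<Sum>j=0..n. krawtchouk n j i)
        + 1 / (2 * real n) * (\<Sum>j=0..n. (real n - 2 * real j) * krawtchouk n j i)
        + t * (\<Sum>j=0..n. \<delta> j * krawtchouk n j i)"
      by (simp only: sum.distrib sum_distrib_left)
    finally show ?thesis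
      using i by (simp add: sum_krawtchouk sum_linear_krawtchouk)
  qed
  have "c j \<ge> 0" if j: "j \<in> {1..n}" for j
  proof (cases "j = n")
    case False
    have "t * \<bar>\<delta> j\<bar> \<le> 1 / (2 * real n ^ 2) * (2 * real n)"
      using bound[of j] j t by (intro mult_mono) auto
    also have "\<dots> = 1 / real n" using n by (simp add: power2_eq_square)
    also have "\<dots> \<le> 1 - real j / real n"
      using False j n by (simp add: field_simps)
    finally have "t * \<bar>\<delta> j\<bar> \<le> 1 - real j / real n" .
    moreover have "- (t * \<bar>\<delta> j\<bar>) \<le> t * \<delta> j"
      using t by (simp add: abs_if)
    ultimately show ?thesis using j by (simp add: c_def)
  qed (use n ends in \<open>simp add: c_def\<close>)
  moreover have "(\<Sum>j=0..n. c j * krawtchouk n j i) \<le> 0" if "i \<in> {2..n}" for i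
    using that t constr[of i] by (simp add: transform mult_nonneg_nonpos)
  ultimately have feas: "delsarte_dual_feasible n 2 c"
    using ends by (auto simp: delsarte_dual_feasible_def c_def)
  show val: "delsarte_dual_objective n c = 2 ^ (n - 1)"
    using n by (simp add: delsarte_dual_objective_eq transform obj power_diff)
  show "delsarte_dual_optimum n 2 c"
    unfolding delsarte_dual_optimum_def is_arg_min_linorder
    using feas val delsarte_dual_objective_ge_half[OF n] by auto
qed

text \<open>Equality in the lower bound forces the transform of an optimum to vanish at every even \<open>i \<ge> 2\<close>, so
  that of \<open>\<delta>\<close> has to be supported on odd indices. With \<open>m\<close> the largest odd index, \<open>\<delta>\<close> combines
  \<open>K\<^sub>1(j)\<close> and \<open>- K\<^sub>m(j)\<close>, scaled to cancel at \<open>j = 0\<close>. Here \<open>m = n\<close> or \<open>m = n - 1\<close> according to the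
  parity of \<open>n\<close>; for \<open>n = 2\<close> the two terms would coincide and \<open>\<delta>\<close> would vanish.\<close>

lemma perturbation_exists:
  assumes n: "n \<ge> 3"
  obtains \<delta> :: "nat \<Rightarrow> real" where
    "\<delta> 0 = 0" "\<delta> n = 0" "\<delta> 1 \<noteq> 0"
    "\<And>j. j \<le> n \<Longrightarrow> \<bar>\<delta> j\<bar> \<le> 2 * real n"
    "(\<Sum>j=0..n. \<delta> j * krawtchouk n j 0) = 0"
    "\<And>i. 2 \<le> i \<Longrightarrow> i \<le> n \<Longrightarrow> (\<Sum>j=0..n. \<delta> j * krawtchouk n j i) \<le> 0"
proof (cases "even n")
  case False
  define \<delta> where "\<delta> j = (real n - 2 * real j) - real n * (-1) ^ j" for j
  have eq: "(\<Sum>j=0..n. \<delta> j * krawtchouk n j i) = (if i = n then - (real n * 2 ^ n) else 0)"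
    if i: "i \<le> n" "i \<noteq> 1" for i
  proof -
    have "(\<Sum>j=0..n. \<delta> j * krawtchouk n j i) =
        (\<Sum>j=0..n. (real n - 2 * real j) * krawtchouk n j i - real n * ((-1) ^ j * krawtchouk n j i))"
      by (intro sum.cong refl) (simp add: \<delta>_def algebra_simps)
    also have "\<dots> = (\<Sum>j=0..n. (real n - 2 * real j) * krawtchouk n j i)
        - real n * (\<Sum>j=0..n. (-1) ^ j * krawtchouk n j i)"
      by (simp only: sum_subtractf sum_distrib_left)
    finally show ?thesis
      using i by (simp add: sum_linear_krawtchouk sum_alternating_krawtchouk)
  qed
  show ?thesis
  proof (rule that[of \<delta>])
    show "\<bar>\<delta> j\<bar> \<le> 2 * real n" if "j \<le> n" for j
      using that by (auto simp: \<delta>_def minus_one_power_iff)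
  qed (use n False in \<open>auto simp: eq\<close>, auto simp: \<delta>_def)
next
  case True
  then have n4: "n \<ge> 4" using n by presburger
  define \<delta> where "\<delta> j = (real n - 2 * real j) * (1 - (-1) ^ j)" for j
  have eq: "(\<Sum>j=0..n. \<delta> j * krawtchouk n j i) = (if i = n - 1 then - (2 ^ n) else 0)"
    if i: "i \<le> n" "i \<noteq> 1" for i
  proof -
    have "(\<Sum>j=0..n. \<delta> j * krawtchouk n j i) =
        (\<Sum>j=0..n. (real n - 2 * real j) * krawtchouk n j i
          - (real n - 2 * real j) * (-1) ^ j * krawtchouk n j i)"
      by (intro sum.cong refl) (simp add: \<delta>_def algebra_simps)
    also have "\<dots> = (\<Sum>j=0..n. (real n - 2 * real j) * krawtchouk n j i)
        - (\<Sum>j=0..n. (real n - 2 * real j) * (-1) ^ j * krawtchouk n j i)"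
      by (simp only: sum_subtractf)
    finally show ?thesis
      using i n by (simp add: sum_linear_krawtchouk sum_alternating_linear_krawtchouk)
  qed
  show ?thesis
  proof (rule that[of \<delta>])
    show "\<bar>\<delta> j\<bar> \<le> 2 * real n" if "j \<le> n" for j
      using that by (auto simp: \<delta>_def minus_one_power_iff)
  qed (use n4 True in \<open>auto simp: eq\<close>, auto simp: \<delta>_def)
qed

section \<open>Uniqueness\<close>

lemma linear_optimum:
  assumes "n \<ge> 1"
  shows "delsarte_dual_optimum n 2 (restrict (\<lambda>j. 1 - real j / real n) {0..n})"
    and "delsarte_dual_objective n (restrict (\<lambda>j. 1 - real j / real n) {0..n}) = 2 ^ (n - 1)"
  using perturbed_linear_optimum(2,1)[of n "\<lambda>_. 0" 0] assms by simp_all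

lemma optimum_two_unique:
  assumes "delsarte_dual_optimum 2 2 c"
  shows "c = restrict (\<lambda>j. 1 - real j / 2) {0..2}"
proof -
  let ?l = "restrict (\<lambda>j. 1 - real j / 2) {0..2::nat}"
  have feas: "delsarte_dual_feasible 2 2 c"
    and le: "delsarte_dual_objective 2 c \<le> delsarte_dual_objective 2 ?l"
    using assms linear_optimum[of 2]
    by (auto simp: delsarte_dual_optimum_def is_arg_min_linorder)
  have c0: "c 0 = 1" and c2: "c 2 \<ge> 0"
    using feas by (auto simp: delsarte_dual_feasible_def)
  have obj: "delsarte_dual_objective 2 c = 1 + 2 * c 1 + c 2"
    by (simp add: delsarte_dual_objective_def numeral_2_eq_2 c0)
  have con: "1 - 2 * c 1 + c 2 \<le> 0"
    using feas by (simp add: delsarte_dual_feasible_def krawtchouk_def numeral_2_eq_2)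
  have "1 + 2 * c 1 + c 2 \<le> 2"
    using le linear_optimum(2)[of 2] obj by simp
  then have "c 1 = 1 / 2" "c 2 = 0" using con c2 by linarith+
  show ?thesis
  proof (rule extensionalityI[of _ "{0..2}"])
    show "c j = ?l j" if "j \<in> {0..2}" for j
    proof -
      have "j = 0 \<or> j = 1 \<or> j = 2" using that unfolding atLeastAtMost_iff by arith
      then show ?thesis using c0 \<open>c 1 = 1 / 2\<close> \<open>c 2 = 0\<close> by auto
    qed
  qed (use feas in \<open>auto simp: delsarte_dual_feasible_def\<close>)
qed

lemma two_optima:
  assumes n: "n \<ge> 3"
  shows "\<exists>c c'. delsarte_dual_optimum n 2 c \<and> delsarte_dual_optimum n 2 c' \<and> c \<noteq> c'"
proof -
  obtain \<delta> :: "nat \<Rightarrow> real" where \<delta>: "\<delta> 0 = 0" "\<delta> n = 0" "\<delta> 1 \<noteq> 0"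
    "\<And>j. j \<le> n \<Longrightarrow> \<bar>\<delta> j\<bar> \<le> 2 * real n"
    "(\<Sum>j=0..n. \<delta> j * krawtchouk n j 0) = 0"
    "\<And>i. 2 \<le> i \<Longrightarrow> i \<le> n \<Longrightarrow> (\<Sum>j=0..n. \<delta> j * krawtchouk n j i) \<le> 0"
    using perturbation_exists[OF n] by blast
  define t :: real where "t = 1 / (2 * real n ^ 2)"
  define c where "c = restrict (\<lambda>j. 1 - real j / real n) {0..n}"
  define c' where "c' = restrict (\<lambda>j. 1 - real j / real n + t * \<delta> j) {0..n}"
  have t: "t > 0" using n by (simp add: t_def)
  have "delsarte_dual_optimum n 2 c'"
    unfolding c'_def
    by (rule perturbed_linear_optimum(2)) (use n t in \<open>auto simp: t_def intro: \<delta>\<close>)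
  moreover have "delsarte_dual_optimum n 2 c"
    unfolding c_def by (rule linear_optimum(1)) (use n in simp)
  moreover have "c 1 \<noteq> c' 1"
    using \<delta>(3) t n by (simp add: c_def c'_def)
  then have "c \<noteq> c'" by auto
  ultimately show ?thesis by blast
qed

theorem theorem3p8:
  fixes n d :: nat
  assumes "n \<ge> 2" and "d = 2"
  shows "(\<exists>!c. delsarte_dual_optimum n d c) \<longleftrightarrow> n = 2"
proof
  assume "\<exists>!c. delsarte_dual_optimum n d c"
  then have "\<not> n \<ge> 3"
    using two_optima[of n] assms(2) by auto
  then show "n = 2" using assms(1) by simp
next
  assume "n = 2"
  then show "\<exists>!c. delsarte_dual_optimum n d c"
    using linear_optimum(1)[of 2] optimum_two_unique assms(2) by auto
qed

end
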